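(* Let $A\in M_R$ be a reciprocal pairwise comparison matrix of order $n$ and let $P$ be any $n\times n$ permutation matrix. Then $KII(PAP^{T})=KII(A)$.
   Context: $M_R$ is the set of all real $n\times n$ matrices $A=(a_{ij})$ with $a_{ij}>0$ for all $i,j$ and $a_{ij}=1/a_{ji}$ for all $i,j$ (reciprocal matrices). Koczkodaj's inconsistency index of $A\in M_R$ is $$KII(A)=\max_{i,j,k\in\{1,\dots,n\}}\ \min\left(\left|1-\frac{a_{ik}}{a_{ij}a_{jk}}\right|,\ \left|1-\frac{a_{ij}a_{jk}}{a_{ik}}\right|\right).$$ *)

theory Defs
  imports "HOL-Analysis.Analysis"
begin

text \<open>
  Matrices of order $n$ are square matrices over a finite index type \<open>'n\<close> with \<open>CARD('n) = n\<close>,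
  so that the order is arbitrary and at least one.
\<close>

definition reciprocal_matrices :: "(real ^ 'n ^ 'n) set" where
  "reciprocal_matrices = {A. (\<forall>i j. A $ i $ j > 0) \<and> (\<forall>i j. A $ i $ j = 1 / A $ j $ i)}"

definition permutation_matrix :: "real ^ 'n ^ 'n \<Rightarrow> bool" where
  "permutation_matrix P \<longleftrightarrow>
     (\<forall>i j. P $ i $ j \<in> {0, 1}) \<and>
     (\<forall>i. \<exists>!j. P $ i $ j = 1) \<and>
     (\<forall>j. \<exists>!i. P $ i $ j = 1)"

text \<open>
  The indices \<open>i\<close>, \<open>j\<close>, \<open>k\<close> need not be distinct. The set of values is finite and nonempty, so
  \<open>Max\<close> is attained; the divisions are meaningful for matrices with positive entries.
\<close>

definition KII :: "real ^ 'n ^ 'n \<Rightarrow> real" where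
  "KII A = Max {min \<bar>1 - A $ i $ k / (A $ i $ j * A $ j $ k)\<bar>
                    \<bar>1 - (A $ i $ j * A $ j $ k) / A $ i $ k\<bar> | i j k. True}"

end

(* Conjugation by the matrix of a permutation s turns the entry (i, j) into the entry (s i, s j),
   so the maximum over triples is merely reindexed by the bijection s. *)
theory Submission
  imports Defs
begin

text \<open>Relabelling the indices permutes the triples (i, j, k), so the same values compete for
  the maximum. \<open>permutation_matrix_obtain\<close> extracts the relabelling from P,
  \<open>permutation_conjugate_entry\<close> shows that conjugation performs it, and
  \<open>KII_reindex\<close> compares the maxima.\<close>

lemma permutation_matrix_obtain:
  fixes P :: "real ^ 'n ^ 'n"
  assumes "permutation_matrix P"
  obtains s where "bij s" "\<And>i j. P $ i $ j = (if j = s i then 1 else 0)"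
proof -
  have entry: "P $ i $ j = 0 \<or> P $ i $ j = 1" for i j
    using assms by (auto simp: permutation_matrix_def)
  have row: "\<exists>!j. P $ i $ j = 1" for i
    using assms by (simp add: permutation_matrix_def)
  have col: "\<exists>!i. P $ i $ j = 1" for j
    using assms by (simp add: permutation_matrix_def)
  define s where "s i = (THE j. P $ i $ j = 1)" for i
  have s: "P $ i $ s i = 1" for i
    unfolding s_def using row by (rule theI')
  have s_eq: "P $ i $ j = 1 \<longleftrightarrow> j = s i" for i j
    using s row by metis
  show thesis
  proof (rule that)
    show "bij s"
      \<comment> \<open>The unique 1 in column j sits in the row that is the unique preimage of j
        under \<open>s\<close>.\<close>
      unfolding bij_iff using col s_eq by metis
    show "P $ i $ j = (if j = s i then 1 else 0)" for i j
      using entry s_eq by metis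
  qed
qed

text \<open>Rows i and j of P each have a single nonzero entry, so both sums of the double product
  collapse to one term.\<close>

lemma permutation_conjugate_entry:
  fixes A P :: "real ^ 'n ^ 'n"
  assumes "\<And>i j. P $ i $ j = (if j = s i then 1 else 0)"
  shows "(P ** A ** transpose P) $ i $ j = A $ s i $ s j"
  by (simp add: matrix_matrix_mult_def transpose_def assms if_distrib if_distribR cong: if_cong)

text \<open>By surjectivity every triple is the image under \<open>s\<close> of some triple, so the
  two sets under \<open>Max\<close> are equal.\<close>

lemma KII_reindex:
  fixes A B :: "real ^ 'n ^ 'n"
  assumes "surj s" and "\<And>i j. B $ i $ j = A $ s i $ s j"
  shows "KII B = KII A"
proof -
  \<comment> \<open>Here \<open>f\<close> stands for the local inconsistency of a triple in
    A.\<close>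
  have reindex: "{f (s i) (s j) (s k) | i j k. True} = {f i j k | i j k. True}"
    for f :: "'n \<Rightarrow> 'n \<Rightarrow> 'n \<Rightarrow> real"
    using surjD[OF \<open>surj s\<close>] by (intro set_eqI) (simp, metis)
  show ?thesis
    unfolding KII_def assms(2)
    by (rule arg_cong[where f = Max], rule reindex)
qed

theorem proposition13:
  fixes A P :: "real ^ 'n ^ 'n"
  assumes "A \<in> reciprocal_matrices"
    and "permutation_matrix P"
  shows "KII (P ** A ** transpose P) = KII A"
proof -
  obtain s where "bij s" and P: "\<And>i j. P $ i $ j = (if j = s i then 1 else 0)"
    using permutation_matrix_obtain[OF assms(2)] by blast
  show ?thesis
    using bij_is_surj[OF \<open>bij s\<close>] permutation_conjugate_entry[OF P] by (rule KII_reindex)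
qed

end
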